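(* Let $\alpha=[\alpha_1,\ldots,\alpha_k]$ be a composition of $n$ such that $n\le 1$ or $\alpha_1>1$. Then $\theta_\alpha=\theta^{BH}_\alpha$.
   Context: A composition $\alpha=[\alpha_1,\ldots,\alpha_k]$ of $n$ ($\alpha\vDash n$) is an ordered list of positive integers summing to $n$; $k(\alpha)=k$; $I(\alpha)=\{\alpha_1,\alpha_1+\alpha_2,\ldots,\alpha_1+\cdots+\alpha_{k-1}\}\subset[n-1]$; $A+1=\{a+1:a\in A\}$. $M_\alpha=\sum_{i_1<\cdots<i_k}x_{i_1}^{\alpha_1}\cdots x_{i_k}^{\alpha_k}$ (indices ranging over $\mathbb{N}$). Define $\theta_\alpha=\sum_{\beta\vDash n,\ I(\alpha)\subset I(\beta)\cup(I(\beta)+1)}2^{k(\beta)}M_\beta$. Let $\mathcal{A}(I(\alpha))$ be the set of weakly increasing sequences $J=(j_1\le j_2\le\cdots\le j_n)$ in $\mathbb{N}$ such that there is no $i\in I(\alpha)$ with $j_{i-1}=j_i=j_{i+1}$. Define \[\theta^{BH}_\alpha=\sum_{J\in\mathcal{A}(I(\alpha))}2^{|J|}x_{j_1}\cdots x_{j_n},\] where $|J|$ is the number of distinct values among $j_1,\ldots,j_n$. *)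

theory Defs
  imports "HOL-Library.Poly_Mapping"
begin

text \<open>
  A formal power series with integer coefficients in commuting variables \<open>x\<^sub>i\<close>, \<open>i :: nat\<close>,
  is given by its coefficients; the monomial \<open>x\<^sub>0 ^ m\<^sub>0 * x\<^sub>1 ^ m\<^sub>1 * \<dots>\<close> is represented by
  its exponent function \<open>m\<close>.
\<close>

type_synonym monomial = "nat \<Rightarrow>\<^sub>0 nat"
type_synonym series = "monomial \<Rightarrow> int"

text \<open>
  The possibly infinite sum, over \<open>s \<in> S\<close>, of \<open>c s\<close> times the monomial \<open>e s\<close>.  It is meaningful
  only when every monomial arises from finitely many \<open>s\<close>; \<open>finite_fibre_M\<close> and
  \<open>finite_fibre_BH\<close> below establish this for the sums used here.
\<close>

definition formal_sum :: "'s set \<Rightarrow> ('s \<Rightarrow> int) \<Rightarrow> ('s \<Rightarrow> monomial) \<Rightarrow> series" where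
  "formal_sum S c e = (\<lambda>m. \<Sum>s | s \<in> S \<and> e s = m. c s)"

definition composition :: "nat \<Rightarrow> nat list \<Rightarrow> bool" where
  "composition n \<alpha> \<longleftrightarrow> (\<forall>a\<in>set \<alpha>. 0 < a) \<and> sum_list \<alpha> = n"

definition I :: "nat list \<Rightarrow> nat set" where
  "I \<alpha> = {sum_list (take r \<alpha>) | r. 1 \<le> r \<and> r < length \<alpha>}"

definition M :: "nat list \<Rightarrow> series" where
  "M \<alpha> = formal_sum {is. length is = length \<alpha> \<and> sorted_wrt (<) is} (\<lambda>_. 1)
           (\<lambda>is. sum_list (map2 Poly_Mapping.single is \<alpha>))"

definition theta :: "nat list \<Rightarrow> series" where
  "theta \<alpha> = (\<lambda>m. \<Sum>\<beta> | composition (sum_list \<alpha>) \<beta> \<and> I \<alpha> \<subseteq> I \<beta> \<union> Suc ` I \<beta>.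
                2 ^ length \<beta> * M \<beta> m)"

text \<open>
  A sequence \<open>j\<^sub>1 \<le> \<dots> \<le> j\<^sub>n\<close> is a list indexed from 0, so that \<open>j\<^sub>i\<close> is \<open>J ! (i - 1)\<close>.  An
  \<open>i \<in> S\<close> for which \<open>i - 1\<close> or \<open>i + 1\<close> is not a position of the sequence imposes no condition.
\<close>

definition BH_sequences :: "nat \<Rightarrow> nat set \<Rightarrow> nat list set" where
  "BH_sequences n S = {J. length J = n \<and> sorted J \<and>
     \<not> (\<exists>i\<in>S. 2 \<le> i \<and> i + 1 \<le> n \<and> J ! (i - 2) = J ! (i - 1) \<and> J ! (i - 1) = J ! i)}"

definition theta_BH :: "nat list \<Rightarrow> series" where
  "theta_BH \<alpha> = formal_sum (BH_sequences (sum_list \<alpha>) (I \<alpha>)) (\<lambda>J. 2 ^ card (set J))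
                  (\<lambda>J. \<Sum>j\<leftarrow>J. Poly_Mapping.single j 1)"

lemma finite_compositions: "finite {\<alpha>. composition n \<alpha>}"
proof (rule finite_subset)
  have "length \<alpha> \<le> sum_list \<alpha>" if "\<forall>a\<in>set \<alpha>. 0 < a" for \<alpha> :: "nat list"
    using that by (induction \<alpha>) auto
  then show "{\<alpha>. composition n \<alpha>} \<subseteq> {\<alpha>. set \<alpha> \<subseteq> {..n} \<and> length \<alpha> \<le> n}"
    by (auto simp: composition_def member_le_sum_list)
qed (simp add: finite_lists_length_le)

lemma keys_add_nat: "Poly_Mapping.keys (p + q) = Poly_Mapping.keys p \<union> Poly_Mapping.keys q"
  for p q :: monomial
  by (auto simp: in_keys_iff lookup_add)

lemma finite_fibre_M:
  fixes \<alpha> :: "nat list" and m :: monomial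
  assumes "\<forall>a\<in>set \<alpha>. 0 < a"
  shows "finite {is. (length is = length \<alpha> \<and> sorted_wrt (<) is) \<and>
    sum_list (map2 Poly_Mapping.single is \<alpha>) = m}"
proof (rule finite_subset)
  have "set is \<subseteq> Poly_Mapping.keys (sum_list (map2 Poly_Mapping.single is \<alpha>))"
    if "length is = length \<alpha>" "\<forall>a\<in>set \<alpha>. 0 < a" for "is" :: "nat list"
    using that
    by (induction "is" \<alpha> rule: list_induct2)
       (auto simp: keys_add_nat)
  then show "{is. (length is = length \<alpha> \<and> sorted_wrt (<) is) \<and>
      sum_list (map2 Poly_Mapping.single is \<alpha>) = m}
    \<subseteq> {is. set is \<subseteq> Poly_Mapping.keys m \<and> length is = length \<alpha>}"
    using assms by blast
qed (simp add: finite_lists_length_eq)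

lemma finite_fibre_BH:
  fixes m :: monomial
  shows "finite {J. J \<in> BH_sequences n S \<and> (\<Sum>j\<leftarrow>J. Poly_Mapping.single j 1) = m}"
proof (rule finite_subset)
  have "set J \<subseteq> Poly_Mapping.keys (\<Sum>j\<leftarrow>J. Poly_Mapping.single j (1::nat))" for J :: "nat list"
    by (induction J) (auto simp: keys_add_nat)
  then show "{J. J \<in> BH_sequences n S \<and> (\<Sum>j\<leftarrow>J. Poly_Mapping.single j 1) = m}
    \<subseteq> {J. set J \<subseteq> Poly_Mapping.keys m \<and> length J = n}"
    by (auto simp: BH_sequences_def)
qed (simp add: finite_lists_length_eq)

end

theory Submission
  imports Defs "HOL-Library.Multiset"
begin

text \<open>
  A weakly increasing sequence \<open>J\<close> is the same thing as a strictly increasing list \<open>is\<close> of values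
  together with a composition \<open>\<beta>\<close> of multiplicities; \<open>I \<beta>\<close> is then the set of positions \<open>i\<close> with
  \<open>j\<^sub>i \<noteq> j\<^sub>i\<^sub>+\<^sub>1\<close>.  Hence \<open>j\<^sub>i\<^sub>-\<^sub>1 = j\<^sub>i = j\<^sub>i\<^sub>+\<^sub>1\<close> fails precisely when \<open>i \<in> I \<beta> \<union> (I \<beta> + 1)\<close>, provided
  \<open>i \<ge> 2\<close>, which \<open>\<alpha>\<^sub>1 > 1\<close> guarantees for all \<open>i \<in> I \<alpha>\<close>.
\<close>

text \<open>The expansion of a run-length encoding. Since \<open>map2\<close> truncates to the
  shorter list, most facts below assume equal lengths.\<close>

definition blocks :: "nat list \<Rightarrow> 'a list \<Rightarrow> 'a list" where
  "blocks \<beta> xs = concat (map2 replicate \<beta> xs)"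

lemma blocks_Nil [simp]: "blocks [] xs = []"
  and blocks_Cons [simp]: "blocks (b # \<beta>) (x # xs) = replicate b x @ blocks \<beta> xs"
  by (simp_all add: blocks_def)

lemma length_blocks: "length \<beta> = length xs \<Longrightarrow> length (blocks \<beta> xs) = sum_list \<beta>"
  by (induction \<beta> xs rule: list_induct2) auto

lemma set_blocks:
  "length \<beta> = length xs \<Longrightarrow> \<forall>b\<in>set \<beta>. 0 < b \<Longrightarrow> set (blocks \<beta> xs) = set xs"
  by (induction \<beta> xs rule: list_induct2) auto

lemma set_blocks_subset: "set (blocks \<beta> xs) \<subseteq> set xs"
  by (auto simp: blocks_def dest: set_zip_rightD split: if_splits)

lemma sorted_blocks:
  fixes xs :: "'a::linorder list"
  shows "length \<beta> = length xs \<Longrightarrow> sorted xs \<Longrightarrow> sorted (blocks \<beta> xs)"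
  by (induction \<beta> xs rule: list_induct2)
     (use set_blocks_subset in \<open>fastforce simp: sorted_append\<close>)+

lemma count_list_replicate: "count_list (replicate n x) y = (if x = y then n else 0)"
  by (induction n) auto

text \<open>Recovers the multiplicities from the expansion: by distinctness \<open>x\<close> does
  not recur after its own block, and that block adds nothing to the counts of the later
  values.\<close>

lemma map_count_list_blocks:
  "length \<beta> = length xs \<Longrightarrow> distinct xs \<Longrightarrow> map (count_list (blocks \<beta> xs)) xs = \<beta>"
proof (induction \<beta> xs rule: list_induct2)
  case (Cons b \<beta> x xs)
  have "count_list (replicate b x @ blocks \<beta> xs) x = b"
    using Cons.prems set_blocks_subset[of \<beta> xs]
    by (auto simp: count_list_replicate count_list_0_iff)
  moreover have "map (count_list (replicate b x @ blocks \<beta> xs)) xs = map (count_list (blocks \<beta> xs)) xs"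
    using Cons.prems by (intro map_cong) (auto simp: count_list_replicate)
  ultimately show ?case
    using Cons by (simp del: count_list_append map_eq_conv)
qed simp

lemma count_list_blocks_map:
  "distinct xs \<Longrightarrow> count_list (blocks (map f xs) xs) y = (if y \<in> set xs then f y else 0)"
  by (induction xs) (auto simp: count_list_replicate)

text \<open>A sorted list is determined by its multiset, so comparing multiplicities is
  enough.\<close>

lemma blocks_count_list:
  fixes J :: "'a::linorder list"
  assumes "sorted J"
  shows "blocks (map (count_list J) (sorted_list_of_set (set J))) (sorted_list_of_set (set J)) = J"
proof -
  let ?xs = "sorted_list_of_set (set J)"
  let ?B = "blocks (map (count_list J) ?xs) ?xs"
  have "count_list ?B y = count_list J y" for y
    by (subst count_list_blocks_map) (auto simp: count_list_0_iff)
  then have "mset ?B = mset J"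
    by (intro multiset_eqI) (simp add: count_mset)
  moreover have "sorted ?B"
    by (rule sorted_blocks) auto
  ultimately show ?thesis
    using assms by (metis properties_for_sort)
qed

text \<open>Matches the monomials of the two series: a block of \<open>b\<close> copies of
  \<open>x\<close> contributes the exponent \<open>b\<close> at \<open>x\<close>.\<close>

lemma sum_single_blocks:
  "length \<beta> = length xs \<Longrightarrow>
    (\<Sum>j\<leftarrow>blocks \<beta> xs. Poly_Mapping.single j (1::nat)) = sum_list (map2 Poly_Mapping.single xs \<beta>)"
proof (induction \<beta> xs rule: list_induct2)
  case (Cons b \<beta> x xs)
  have "sum_list (replicate b (Poly_Mapping.single x (1::nat))) = Poly_Mapping.single x b"
    by (induction b) (auto simp flip: single_add)
  then show ?case
    using Cons by simp
qed simp

text \<open>Prepending \<open>b\<close> shifts the partial sums of \<open>\<beta>\<close> by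
  \<open>b\<close> and adds \<open>b\<close> itself as the smallest. The condition
  \<open>b < i\<close> keeps the subtraction on naturals exact.\<close>

lemma I_Cons:
  assumes "\<forall>b\<in>set \<beta>. 0 < b"
  shows "i \<in> I (b # \<beta>) \<longleftrightarrow> \<beta> \<noteq> [] \<and> (i = b \<or> b < i \<and> i - b \<in> I \<beta>)"
proof
  assume "i \<in> I (b # \<beta>)"
  then obtain r where r: "i = sum_list (take r (b # \<beta>))" "1 \<le> r" "r < Suc (length \<beta>)"
    by (auto simp: I_def)
  then obtain q where q: "r = Suc q" "q < length \<beta>"
    by (cases r) auto
  show "\<beta> \<noteq> [] \<and> (i = b \<or> b < i \<and> i - b \<in> I \<beta>)"
  proof (cases "q = 0")
    case True
    then show ?thesis using r q by auto
  next
    case False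
    then have "i - b \<in> I \<beta>"
      using r q by (auto simp: I_def)
    \<comment> \<open>Positive parts make this nonempty partial sum positive, whence
      \<open>b < i\<close> strictly.\<close>
    moreover have "0 < sum_list (take q \<beta>)"
      using assms q False by (cases \<beta>; cases q) auto
    ultimately show ?thesis using r q by auto
  qed
next
  assume R: "\<beta> \<noteq> [] \<and> (i = b \<or> b < i \<and> i - b \<in> I \<beta>)"
  show "i \<in> I (b # \<beta>)"
  proof (cases "i = b")
    case True
    then show ?thesis using R by (auto simp: I_def intro!: exI[of _ 1])
  next
    case False
    then obtain r where "i = b + sum_list (take r \<beta>)" "1 \<le> r" "r < length \<beta>"
      using R by (auto simp: I_def) (metis add_diff_inverse_nat less_imp_not_less)
    then show ?thesis by (auto simp: I_def intro!: exI[of _ "Suc r"])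
  qed
qed

text \<open>Values are constant inside a block, and distinctness of \<open>xs\<close> makes
  neighbouring blocks differ. The list entries \<open>i - 1\<close> and \<open>i\<close> are the
  terms number \<open>i\<close> and \<open>i + 1\<close> of the sequence.\<close>

lemma I_blocks:
  "length \<beta> = length xs \<Longrightarrow> \<forall>b\<in>set \<beta>. 0 < b \<Longrightarrow> distinct xs \<Longrightarrow>
    i \<in> I \<beta> \<longleftrightarrow> 1 \<le> i \<and> i < sum_list \<beta> \<and> blocks \<beta> xs ! (i - 1) \<noteq> blocks \<beta> xs ! i"
proof (induction \<beta> xs arbitrary: i rule: list_induct2)
  case Nil
  then show ?case by (simp add: I_def)
next
  case (Cons b \<beta> x xs)
  have b: "0 < b" and \<beta>: "\<forall>b\<in>set \<beta>. 0 < b" using Cons.prems by auto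
  show ?case
  proof (cases "\<beta> = []")
    case True
    then show ?thesis using Cons.hyps by (auto simp: I_def)
  next
    case False
    then obtain c \<beta>' y ys where eq: "\<beta> = c # \<beta>'" "xs = y # ys"
      using Cons.hyps by (cases \<beta>; cases xs) auto
    \<comment> \<open>For \<open>1 \<le> i\<close>, the two compared entries lie both in the first
      block, on either side of its end, or both in the remaining blocks.\<close>
    consider "i < b" | "i = b" | "b < i" by linarith
    then show ?thesis
    proof cases
      case 1
      then show ?thesis by (auto simp: I_Cons[OF \<beta>] nth_append)
    next
      case 2
      then show ?thesis
        using eq Cons.prems b I_Cons[OF \<beta>, of i b] by (auto simp: nth_append)
    next
      case 3
      then show ?thesis
        using False Cons.IH[OF \<beta>, of "i - b"] Cons.prems
        by (auto simp: I_Cons[OF \<beta>] nth_append Suc_diff_le)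
    qed
  qed
qed

text \<open>Such a partial sum includes the first part and omits at least one positive part.\<close>

lemma I_bounds:
  assumes "\<forall>a\<in>set \<alpha>. 0 < a" "i \<in> I \<alpha>"
  shows "hd \<alpha> \<le> i" "i < sum_list \<alpha>"
proof -
  obtain r where r: "i = sum_list (take r \<alpha>)" "1 \<le> r" "r < length \<alpha>"
    using assms(2) by (auto simp: I_def)
  then show "hd \<alpha> \<le> i"
    by (cases \<alpha>; cases r) auto
  have "sum_list \<alpha> = i + sum_list (drop r \<alpha>)"
    using r by (metis append_take_drop_id sum_list_append)
  moreover have "drop r \<alpha> = \<alpha> ! r # drop (Suc r) \<alpha>"
    using r by (simp add: Cons_nth_drop_Suc)
  ultimately show "i < sum_list \<alpha>"
    using assms(1) r by simp
qed

text \<open>Three equal consecutive entries around \<open>i\<close> mean no change of value at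
  \<open>i - 1\<close> or at \<open>i\<close>. The bounds on \<open>S\<close> ensure that all three
  entries exist; at \<open>i = 1\<close> the left side would impose nothing, while the right side
  would still require \<open>1 \<in> I \<beta>\<close>.\<close>

lemma blocks_in_BH_sequences_iff:
  fixes xs :: "nat list"
  assumes "length \<beta> = length xs" "\<forall>b\<in>set \<beta>. 0 < b" "sorted_wrt (<) xs"
    and S: "\<And>i. i \<in> S \<Longrightarrow> 2 \<le> i \<and> i < sum_list \<beta>"
  shows "blocks \<beta> xs \<in> BH_sequences (sum_list \<beta>) S \<longleftrightarrow> S \<subseteq> I \<beta> \<union> Suc ` I \<beta>"
proof -
  have xs: "sorted xs" "distinct xs"
    using assms(3) by (auto simp: strict_sorted_iff)
  note I = I_blocks[OF assms(1,2) xs(2)]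
  have "i \<in> I \<beta> \<union> Suc ` I \<beta> \<longleftrightarrow>
      \<not> (blocks \<beta> xs ! (i - 2) = blocks \<beta> xs ! (i - 1) \<and> blocks \<beta> xs ! (i - 1) = blocks \<beta> xs ! i)"
    if "i \<in> S" for i
  proof -
    have "i \<in> Suc ` I \<beta> \<longleftrightarrow> i - 1 \<in> I \<beta>"
      using S[OF that] by (cases i) auto
    then show ?thesis
      using S[OF that] I[of i] I[of "i - 1"] by (auto simp: numeral_2_eq_2)
  qed
  then show ?thesis
    using S length_blocks[OF assms(1)] sorted_blocks[OF assms(1) xs(1)]
    by (fastforce simp: BH_sequences_def)
qed

lemma theta_eq_theta_BH:
  assumes "\<And>i. i \<in> I \<alpha> \<Longrightarrow> 2 \<le> i \<and> i < sum_list \<alpha>"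
  shows "theta \<alpha> = theta_BH \<alpha>"
proof
  fix m :: monomial
  define C where "C = {\<beta>. composition (sum_list \<alpha>) \<beta> \<and> I \<alpha> \<subseteq> I \<beta> \<union> Suc ` I \<beta>}"
  define T where "T \<beta> = {xs. (length xs = length \<beta> \<and> sorted_wrt (<) xs) \<and>
    sum_list (map2 Poly_Mapping.single xs \<beta>) = m}" for \<beta> :: "nat list"
  define B where "B = {J. J \<in> BH_sequences (sum_list \<alpha>) (I \<alpha>) \<and>
    (\<Sum>j\<leftarrow>J. Poly_Mapping.single j 1) = m}"
  have C: "finite C"
    unfolding C_def by (rule finite_subset[OF _ finite_compositions[of "sum_list \<alpha>"]]) auto
  \<comment> \<open>Finiteness of \<open>C\<close> and of each \<open>T \<beta>\<close> allows the
    double sum to become one sum over pairs.\<close>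
  have T: "\<forall>\<beta>\<in>C. finite (T \<beta>)"
    unfolding C_def T_def composition_def using finite_fibre_M by auto
  let ?vals = "\<lambda>J. sorted_list_of_set (set J)"
  \<comment> \<open>Run-length encoding, the candidate inverse of \<open>blocks\<close>.\<close>
  define dec where "dec J = (map (count_list J) (?vals J), ?vals J)" for J :: "nat list"
  have blocks: "dec (blocks \<beta> xs) = (\<beta>, xs) \<and> blocks \<beta> xs \<in> B" if "\<beta> \<in> C" "xs \<in> T \<beta>" for \<beta> xs
  proof -
    from that have *: "length \<beta> = length xs" "\<forall>b\<in>set \<beta>. 0 < b" "sorted_wrt (<) xs"
        "sum_list \<beta> = sum_list \<alpha>" "I \<alpha> \<subseteq> I \<beta> \<union> Suc ` I \<beta>"
        "sum_list (map2 Poly_Mapping.single xs \<beta>) = m"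
      by (auto simp: C_def T_def composition_def)
    have "?vals (blocks \<beta> xs) = xs"
      using * set_blocks[OF *(1,2)] by (simp add: sorted_list_of_set.idem_if_sorted_distinct strict_sorted_iff)
    then have "dec (blocks \<beta> xs) = (\<beta>, xs)"
      using * map_count_list_blocks[OF *(1)] by (simp add: dec_def strict_sorted_iff)
    moreover have "blocks \<beta> xs \<in> B"
      using * assms blocks_in_BH_sequences_iff[OF *(1,2,3), of "I \<alpha>"] sum_single_blocks[OF *(1)]
      by (simp add: B_def)
    ultimately show ?thesis ..
  qed
  have dec: "dec J \<in> Sigma C T \<and> (case dec J of (\<beta>, xs) \<Rightarrow> blocks \<beta> xs) = J" if "J \<in> B" for J
  proof -
    from that have J: "J \<in> BH_sequences (sum_list \<alpha>) (I \<alpha>)" "(\<Sum>j\<leftarrow>J. Poly_Mapping.single j 1) = m"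
      and s: "sorted J" "length J = sum_list \<alpha>"
      by (auto simp: B_def BH_sequences_def)
    define xs \<beta> where "xs = ?vals J" and "\<beta> = map (count_list J) xs"
    have bl: "blocks \<beta> xs = J"
      unfolding \<beta>_def xs_def by (rule blocks_count_list[OF s(1)])
    have *: "length \<beta> = length xs" "\<forall>b\<in>set \<beta>. 0 < b" "sorted_wrt (<) xs"
      by (auto simp: \<beta>_def xs_def count_list_0_iff intro: gr0I)
    have sum: "sum_list \<beta> = sum_list \<alpha>"
      using length_blocks[OF *(1)] s bl by simp
    have "\<beta> \<in> C"
      using J(1) assms * sum blocks_in_BH_sequences_iff[OF *, of "I \<alpha>"] bl
      by (simp add: C_def composition_def)
    moreover have "xs \<in> T \<beta>"
      using J(2) * sum_single_blocks[OF *(1)] bl by (simp add: T_def)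
    ultimately show ?thesis
      using bl by (simp add: dec_def \<beta>_def xs_def)
  qed
  have bij: "bij_betw (\<lambda>(\<beta>, xs). blocks \<beta> xs) (Sigma C T) B"
    by (rule bij_betw_byWitness[where f' = dec]) (use blocks dec in \<open>auto simp: image_subset_iff\<close>)
  have "theta \<alpha> m = (\<Sum>\<beta>\<in>C. \<Sum>xs\<in>T \<beta>. 2 ^ length \<beta>)"
    by (simp add: theta_def M_def formal_sum_def C_def T_def mult.commute)
  also have "\<dots> = (\<Sum>(\<beta>, xs)\<in>Sigma C T. 2 ^ length \<beta>)"
    by (rule sum.Sigma[OF C T])
  \<comment> \<open>The weights agree: every multiplicity is positive and \<open>xs\<close> is
    distinct, so the expansion has exactly \<open>length \<beta>\<close> distinct values.\<close>
  also have "\<dots> = (\<Sum>p\<in>Sigma C T. 2 ^ card (set (case p of (\<beta>, xs) \<Rightarrow> blocks \<beta> xs)))"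
    by (rule sum.cong)
       (auto simp: C_def T_def composition_def set_blocks strict_sorted_iff distinct_card)
  also have "\<dots> = (\<Sum>J\<in>B. 2 ^ card (set J))"
    by (rule sum.reindex_bij_betw[OF bij])
  also have "\<dots> = theta_BH \<alpha> m"
    by (simp add: theta_BH_def formal_sum_def B_def)
  finally show "theta \<alpha> m = theta_BH \<alpha> m" .
qed

theorem theorem3p5:
  fixes n :: nat and \<alpha> :: "nat list"
  assumes "composition n \<alpha>"
    and "n \<le> 1 \<or> hd \<alpha> > 1"
  shows "theta \<alpha> = theta_BH \<alpha>"
proof (rule theta_eq_theta_BH)
  fix i assume i: "i \<in> I \<alpha>"
  have pos: "\<forall>a\<in>set \<alpha>. 0 < a" and n: "sum_list \<alpha> = n"
    using assms(1) by (auto simp: composition_def)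
  \<comment> \<open>If \<open>n \<le> 1\<close>, then \<open>0 < hd \<alpha>\<close>,
    \<open>hd \<alpha> \<le> i\<close> and \<open>i < n\<close> contradict each other, so
    \<open>I \<alpha>\<close> is empty; otherwise \<open>1 < hd \<alpha>\<close> gives
    \<open>2 \<le> i\<close>.\<close>
  have "\<alpha> \<noteq> []"
    using i by (auto simp: I_def)
  then have "0 < hd \<alpha>"
    using pos by simp
  then show "2 \<le> i \<and> i < sum_list \<alpha>"
    using I_bounds[OF pos i] assms(2) n by linarith
qed

end
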